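(* Let $A\in\mathbb{R}^{m\times n}$ be nonzero and $b\in\mathbb{R}^m$. Let $\mathcal{D}$ be a distribution of random matrix quadruples $(S_1,S_2,T_1,T_2)$ satisfying $\mathbb{E}[T_1T_2^\top A^\top S_1S_2^\top]=\frac{A^\top}{\|A\|_F^2}$. Let $x^1=x^0\in\mathbb{R}^n$ be arbitrary (deterministic) initial vectors, let $x^0_*=A^{\dagger}b+(I-A^\dagger A)x^0$, and let $\{x^k\}$ be generated by the mPFR iteration $$x^{k+1}=x^{k}-\alpha T_1T_2^\top A^\top S_1S_2^\top(Ax^{k}-b)+\omega(x^k-x^{k-1}),\qquad k\ge 1,$$ where at each iteration a fresh quadruple $(S_1,S_2,T_1,T_2)$ is drawn independently from $\mathcal{D}$. Assume that $0<\alpha\leq\frac{\|A\|^2_F}{\sigma_{\max}^2(A)}$ and $$\left(1-\sqrt{\alpha\sigma_{\min}^2(A)/\|A\|^2_F}\right)^2<\omega<1.$$ Then there exists a constant $c>0$ (independent of $k$) such that for all $k\geq 0$, $$\left\|\mathbb{E}\left[x^k-x_*^0\right]\right\|_2^2\leq \omega^k c.$$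
   Context: $A^\dagger$ is the Moore-Penrose pseudoinverse; $\|\cdot\|_F$ is the Frobenius norm; $\|\cdot\|_2$ is the Euclidean norm; $\sigma_{\max}(A)$ is the largest singular value and $\sigma_{\min}(A)$ the smallest nonzero singular value of $A$. The linear system $Ax=b$ may be consistent or inconsistent and $A$ may have any rank. The random matrices have sizes $S_1,S_2\in\mathbb{R}^{m\times p}$ and $T_1,T_2\in\mathbb{R}^{n\times s}$, where $p,s$ may themselves be random; the four matrices in a quadruple need not be independent of each other, but quadruples used at different iterations are independent and identically distributed. All expectations appearing are assumed to exist and be finite. *)

theory Defs
  imports "HOL-Probability.Probability"
begin

text \<open>
  The first dimension of a matrix in \<open>real^'n^'m\<close> is its row index, so this is the type of
  \<open>m \<times> n\<close> matrices, and \<^const>\<open>norm\<close> on it is the Frobenius norm.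
\<close>

definition is_pseudoinverse :: "real^'n^'m \<Rightarrow> real^'m^'n \<Rightarrow> bool" where
  "is_pseudoinverse A X \<longleftrightarrow>
     A ** X ** A = A \<and> X ** A ** X = X \<and>
     transpose (A ** X) = A ** X \<and> transpose (X ** A) = X ** A"

definition pseudoinverse :: "real^'n^'m \<Rightarrow> real^'m^'n" where
  "pseudoinverse A = (THE X. is_pseudoinverse A X)"

text \<open>
  For \<open>m < n\<close> this set contains \<open>0\<close> even if \<open>A\<close> has full row rank; that affects neither the
  largest nor the smallest nonzero singular value of a nonzero matrix.
\<close>

definition singular_values :: "real^'n^'m \<Rightarrow> real set" where
  "singular_values A =
     {sqrt l | l. \<exists>v. v \<noteq> 0 \<and> (transpose A ** A) *v v = l *\<^sub>R v}"

definition sigma_max :: "real^'n^'m \<Rightarrow> real" where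
  "sigma_max A = Max (singular_values A)"

definition sigma_min :: "real^'n^'m \<Rightarrow> real" where
  "sigma_min A = Min (singular_values A - {0})"

text \<open>
  A matrix with \<open>d\<close> rows and a random number \<open>p\<close> of columns is encoded by \<open>p\<close> together with
  a sequence of columns \<open>S :: nat \<Rightarrow> real^'d\<close>: entry \<open>(i, l)\<close> is \<open>S l $ i\<close> for \<open>l < p\<close>, and the
  columns from \<open>p\<close> on are never used.  A quadruple \<open>(p, s, S1, S2, T1, T2)\<close> thus stands for
  \<open>S1, S2\<close> of size \<open>m \<times> p\<close> and \<open>T1, T2\<close> of size \<open>n \<times> s\<close>.  All component types are second
  countable, so \<^const>\<open>borel\<close> on this type is the product \<open>\<sigma>\<close>-algebra: measurability means that
  \<open>p\<close>, \<open>s\<close> and all matrix entries are random variables.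
\<close>

type_synonym ('m, 'n) quadruple =
  "nat \<times> nat \<times> (nat \<Rightarrow> real^'m) \<times> (nat \<Rightarrow> real^'m) \<times> (nat \<Rightarrow> real^'n) \<times> (nat \<Rightarrow> real^'n)"

definition mult_transpose :: "nat \<Rightarrow> (nat \<Rightarrow> real^'d) \<Rightarrow> (nat \<Rightarrow> real^'d) \<Rightarrow> real^'d^'d" where
  "mult_transpose p S1 S2 = (\<chi> i j. \<Sum>l<p. S1 l $ i * S2 l $ j)"

text \<open>The matrix \<open>T1 T2\<^sup>T A\<^sup>T S1 S2\<^sup>T\<close>.\<close>

fun sketch :: "real^'n^'m \<Rightarrow> ('m, 'n) quadruple \<Rightarrow> real^'m^'n" where
  "sketch A (p, s, S1, S2, T1, T2) =
     mult_transpose s T1 T2 ** transpose A ** mult_transpose p S1 S2"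

end

theory Submission
  imports Defs
begin

text \<open>
  The iterate \<open>x\<^sup>k\<close> is a function of the quadruples drawn before step \<open>k\<close>, hence independent of the
  \<open>k\<close>-th one, and \<open>A\<^sup>T A x\<^sub>* = A\<^sup>T b\<close>. So \<open>e\<^sub>k = E[x\<^sup>k - x\<^sub>*]\<close> obeys the deterministic heavy ball
  recursion \<open>e\<^sub>k\<^sub>+\<^sub>1 = B e\<^sub>k - \<omega> e\<^sub>k\<^sub>-\<^sub>1\<close> with \<open>B = (1 + \<omega>) I - \<alpha> A\<^sup>T A / \<parallel>A\<parallel>\<^sup>2\<close>, and it stays in the
  range of \<open>A\<^sup>T\<close>. As \<open>B\<close> is symmetric, the quadratic form
  \<open>V\<^sub>k = \<parallel>e\<^sub>k\<^sub>+\<^sub>1\<parallel>\<^sup>2 - \<langle>B e\<^sub>k\<^sub>+\<^sub>1, e\<^sub>k\<rangle> + \<omega> \<parallel>e\<^sub>k\<parallel>\<^sup>2\<close> satisfies \<open>V\<^sub>k\<^sub>+\<^sub>1 = \<omega> V\<^sub>k\<close> exactly, so no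
  diagonalisation is needed. On the range of \<open>A\<^sup>T\<close> the eigenvalues of \<open>B\<close> lie between \<open>0\<close> and
  \<open>1 + \<omega> - \<alpha> \<sigma>\<^sub>m\<^sub>i\<^sub>n\<^sup>2 / \<parallel>A\<parallel>\<^sup>2\<close>, and the lower bound on \<open>\<omega>\<close> says that the latter is less than
  \<open>2 \<surd>\<omega>\<close>, which makes \<open>V\<close> positive definite.
\<close>

section \<open>Adjoints and the Gram matrix\<close>

lemma inner_transpose_matrix:
  fixes A :: "real^'n^'m"
  shows "(transpose A *v y) \<bullet> x = y \<bullet> (A *v x)"
  by (simp add: dot_lmul_matrix)

text \<open>The rule rewrites \<open>transpose A *v y\<close> to \<open>y v* A\<close>, which would
  hide the Gram form used from here on.\<close>

declare transpose_matrix_vector [simp del]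

lemma inner_gram:
  fixes A :: "real^'n^'m"
  shows "(transpose A *v (A *v x)) \<bullet> y = (A *v x) \<bullet> (A *v y)"
  by (rule inner_transpose_matrix)

lemma gram_eq_0_iff:
  fixes A :: "real^'n^'m"
  shows "transpose A *v (A *v x) = 0 \<longleftrightarrow> A *v x = 0"
  using inner_gram[of A x x] by auto

subsection \<open>The Moore-Penrose inverse\<close>

text \<open>Split \<open>y\<close> orthogonally along the range of \<open>A\<close>: one part is
  some \<open>A *v w\<close>, and the residual \<open>z\<close> is orthogonal to every
  \<open>A *v x\<close>, so \<open>transpose A\<close> kills it.\<close>

lemma normal_equation_solvable:
  fixes A :: "real^'n^'m"
  shows "\<exists>w. transpose A *v (A *v w) = transpose A *v y"
proof -
  have S: "subspace (range ((*v) A))"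
    by (simp add: linear_subspace_image matrix_vector_mul_linear)
  obtain u z where u: "u \<in> span (range ((*v) A))"
    and z: "\<And>w. w \<in> span (range ((*v) A)) \<Longrightarrow> orthogonal z w" and y: "y = u + z"
    using orthogonal_subspace_decomp_exists[of "range ((*v) A)" y] by blast
  from u S obtain w where w: "u = A *v w"
    by (auto simp: span_eq_iff[THEN iffD2])
  have "(transpose A *v z) \<bullet> x = 0" for x
    using z[of "A *v x"] by (simp add: inner_transpose_matrix orthogonal_def span_base)
  then have "transpose A *v z = 0"
    using inner_eq_zero_iff by blast
  with y w show ?thesis
    by (auto simp: matrix_vector_right_distrib)
qed

text \<open>Solving the normal equation for \<open>A\<close> and then for \<open>transpose A\<close>
  moves the solution into the range of \<open>transpose A\<close>. The matrix
  \<open>transpose A ** Z\<close> will be the pseudoinverse.\<close>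

lemma gram_factor_exists:
  fixes A :: "real^'n^'m"
  shows "\<exists>Z. transpose A ** A ** transpose A ** Z = transpose A"
proof -
  have "\<exists>z. transpose A *v (A *v (transpose A *v z)) = transpose A *v y" for y
  proof -
    obtain w where w: "transpose A *v (A *v w) = transpose A *v y"
      using normal_equation_solvable by blast
    obtain z where z: "A *v (transpose A *v z) = A *v w"
      using normal_equation_solvable[of "transpose A" w] by auto
    show ?thesis
      using w z by metis
  qed
  then obtain z where z: "\<And>y. transpose A *v (A *v (transpose A *v z y)) = transpose A *v y"
    by metis
  \<comment> \<open>The choice function \<open>z\<close> may fail to be linear; only its values at
    the basis vectors enter, as columns.\<close>
  define Z :: "real^'m^'m" where "Z = (\<chi> i j. z (axis j 1) $ i)"
  have Z: "Z *v axis j 1 = z (axis j 1)" for j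
    by (simp add: Z_def matrix_vector_mult_basis column_def vec_eq_iff)
  have "(transpose A ** A ** transpose A ** Z) *v axis j 1 = transpose A *v axis j 1" for j
    by (simp only: matrix_vector_mul_assoc[symmetric] Z z)
  then have "column j (transpose A ** A ** transpose A ** Z) = column j (transpose A)" for j
    by (simp only: matrix_vector_mult_basis)
  then show ?thesis
    by (intro exI[of _ Z]) (simp add: column_def vec_eq_iff)
qed

text \<open>Both \<open>P = A ** X\<close> and \<open>P = X ** A\<close> satisfy
  \<open>transpose P ** P = P\<close>, which forces \<open>P\<close> to be symmetric.\<close>

lemma is_pseudoinverse_exists:
  fixes A :: "real^'n^'m"
  shows "\<exists>X. is_pseudoinverse A X"
proof -
  obtain Z where Z: "transpose A ** A ** transpose A ** Z = transpose A"
    using gram_factor_exists by blast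
  define X where "X = transpose A ** Z"
  have AAX: "transpose A ** (A ** X) = transpose A"
    using Z by (simp add: X_def matrix_mul_assoc)
  then have "transpose (transpose A ** (A ** X)) = A"
    by simp
  then have PA: "transpose (A ** X) ** A = A"
    by (simp add: matrix_transpose_mul)
  then have PP: "transpose (A ** X) ** (A ** X) = A ** X"
    by (metis matrix_mul_assoc)
  then have P: "transpose (A ** X) = A ** X"
    by (metis matrix_transpose_mul transpose_transpose)
  have AXA: "A ** X ** A = A"
    using PA P by simp
  then have "transpose (A ** (X ** A)) = transpose A"
    by (simp add: matrix_mul_assoc)
  then have "transpose (X ** A) ** transpose A = transpose A"
    by (simp only: matrix_transpose_mul)
  \<comment> \<open>Whatever fixes \<open>transpose A\<close> from the left also fixes
    \<open>X = transpose A ** Z\<close>.\<close>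
  then have RX: "transpose (X ** A) ** X = X"
    by (metis X_def matrix_mul_assoc)
  then have "transpose (X ** A) ** (X ** A) = X ** A"
    by (metis matrix_mul_assoc)
  then have R: "transpose (X ** A) = X ** A"
    by (metis matrix_transpose_mul transpose_transpose)
  show ?thesis
    using AXA P R RX unfolding is_pseudoinverse_def by metis
qed

text \<open>Transposing the Penrose identities yields \<open>A ** X = A ** Y\<close> and
  \<open>X ** A = Y ** A\<close>; then \<open>X = X ** A ** X\<close> can be turned into
  \<open>Y ** A ** Y\<close> one factor at a time.\<close>

lemma is_pseudoinverse_unique:
  fixes A :: "real^'n^'m"
  assumes X: "is_pseudoinverse A X" and Y: "is_pseudoinverse A Y"
  shows "X = Y"
proof -
  have "A ** X = (A ** Y) ** (A ** X)"
    using Y by (simp add: is_pseudoinverse_def matrix_mul_assoc)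
  then have "transpose (A ** X) = transpose (A ** X) ** transpose (A ** Y)"
    by (metis matrix_transpose_mul)
  then have "A ** X = (A ** X) ** (A ** Y)"
    using X Y by (simp add: is_pseudoinverse_def)
  then have 1: "A ** X = A ** Y"
    using X by (simp add: is_pseudoinverse_def matrix_mul_assoc)
  have "X ** A = (X ** A) ** (Y ** A)"
    using Y by (metis is_pseudoinverse_def matrix_mul_assoc)
  then have "transpose (X ** A) = transpose (Y ** A) ** transpose (X ** A)"
    by (metis matrix_transpose_mul)
  then have "X ** A = (Y ** A) ** (X ** A)"
    using X Y by (simp add: is_pseudoinverse_def)
  then have 2: "X ** A = Y ** A"
    using X by (metis is_pseudoinverse_def matrix_mul_assoc)
  have "X = X ** (A ** X)"
    using X by (simp add: is_pseudoinverse_def matrix_mul_assoc)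
  also have "\<dots> = Y ** (A ** Y)"
    by (metis 1 2 matrix_mul_assoc)
  finally show ?thesis
    using Y by (simp add: is_pseudoinverse_def matrix_mul_assoc)
qed

lemma is_pseudoinverse_pseudoinverse: "is_pseudoinverse A (pseudoinverse A)"
  unfolding pseudoinverse_def
  by (rule theI') (metis is_pseudoinverse_exists is_pseudoinverse_unique)

text \<open>This makes \<open>xstar\<close> a solution of the normal equations, for consistent and
  inconsistent systems alike.\<close>

lemma transpose_mult_pseudoinverse: "transpose A ** (A ** pseudoinverse A) = transpose A"
  using is_pseudoinverse_pseudoinverse[of A] unfolding is_pseudoinverse_def
  by (metis matrix_transpose_mul)

text \<open>Symmetry of \<open>X ** A\<close> pulls a factor \<open>transpose A\<close> out on the
  left. It places the initial error in the range of \<open>transpose A\<close>.\<close>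

lemma pseudoinverse_in_range_transpose:
  "pseudoinverse A *v y \<in> range ((*v) (transpose A))"
proof -
  let ?X = "pseudoinverse A"
  have X: "?X = ?X ** A ** ?X" "?X ** A = transpose (?X ** A)"
    using is_pseudoinverse_pseudoinverse[of A] by (simp_all add: is_pseudoinverse_def)
  then have "?X = transpose (?X ** A) ** ?X"
    by metis
  then have "?X = transpose A ** (transpose ?X ** ?X)"
    by (simp only: matrix_transpose_mul matrix_mul_assoc)
  then have "?X *v y = transpose A *v ((transpose ?X ** ?X) *v y)"
    by (metis matrix_vector_mul_assoc)
  then show ?thesis
    by blast
qed

subsection \<open>Extreme singular values\<close>

text \<open>A maximiser of the Rayleigh quotient on the unit sphere of \<open>S\<close> is an
  eigenvector, since the first variation along its residual must vanish. An invariant subspace is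
  allowed so that the kernel of \<open>A\<close> can be excluded.\<close>

lemma ex_maximizing_eigenvector:
  fixes f :: "'a::euclidean_space \<Rightarrow> 'a"
  assumes f: "linear f" and S: "subspace S" "S \<noteq> {0}" and fS: "f ` S \<subseteq> S"
    and sym: "\<And>u v. u \<in> S \<Longrightarrow> v \<in> S \<Longrightarrow> f u \<bullet> v = f v \<bullet> u"
  obtains l v where "v \<in> S" "v \<noteq> 0" "f v = l *\<^sub>R v" "\<And>u. u \<in> S \<Longrightarrow> f u \<bullet> u \<le> l * (u \<bullet> u)"
proof -
  have "compact (S \<inter> sphere 0 1)"
    using S by (intro closed_Int_compact closed_subspace) auto
  moreover obtain w where w: "w \<in> S" "w \<noteq> 0"
    using S subspace_0 by blast
  then have "w /\<^sub>R norm w \<in> S \<inter> sphere 0 1"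
    using S by (auto intro: subspace_scale)
  then have "S \<inter> sphere 0 1 \<noteq> {}"
    by blast
  moreover have "continuous_on (S \<inter> sphere 0 1) (\<lambda>u. f u \<bullet> u)"
    using f by (intro continuous_intros linear_continuous_on) (simp add: linear_conv_bounded_linear)
  ultimately have "\<exists>v\<in>S \<inter> sphere 0 1. \<forall>u\<in>S \<inter> sphere 0 1. f u \<bullet> u \<le> f v \<bullet> v"
    by (intro continuous_attains_sup)
  then obtain v where v: "v \<in> S" "norm v = 1"
    and max: "\<And>u. u \<in> S \<Longrightarrow> norm u = 1 \<Longrightarrow> f u \<bullet> u \<le> f v \<bullet> v"
    by (metis IntD1 IntD2 IntI mem_sphere_0)
  define l where "l = f v \<bullet> v"
  have le: "f u \<bullet> u \<le> l * (u \<bullet> u)" if "u \<in> S" for u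
  proof (cases "u = 0")
    case True
    then show ?thesis by simp
  next
    case False
    have "f (u /\<^sub>R norm u) \<bullet> (u /\<^sub>R norm u) \<le> l"
      unfolding l_def using that S False by (intro max) (auto intro: subspace_scale)
    then have "(f u \<bullet> u) / (norm u)\<^sup>2 \<le> l"
      by (simp add: linear_scale[OF f] power2_eq_square divide_inverse mult_ac)
    then show ?thesis
      using False by (simp add: divide_le_eq power2_norm_eq_inner)
  qed
  \<comment> \<open>The residual of the eigenvector equation; invariance of \<open>S\<close> makes
    it an admissible direction.\<close>
  define w where "w = l *\<^sub>R v - f v"
  have wS: "w \<in> S"
    using v S fS by (auto simp: w_def intro!: subspace_diff subspace_scale)
  define q where "q = l * (w \<bullet> w) - f w \<bullet> w"
  have q: "q \<ge> 0"
    using le[OF wS] by (simp add: q_def)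
  have quad: "0 \<le> 2 * t * (w \<bullet> w) + t\<^sup>2 * q" for t :: real
  proof -
    have "f (v + t *\<^sub>R w) \<bullet> (v + t *\<^sub>R w) \<le> l * ((v + t *\<^sub>R w) \<bullet> (v + t *\<^sub>R w))"
      using v wS S by (intro le) (auto intro!: subspace_add subspace_scale)
    moreover have "f (v + t *\<^sub>R w) \<bullet> (v + t *\<^sub>R w) = l + 2 * t * (f v \<bullet> w) + t\<^sup>2 * (f w \<bullet> w)"
      using sym[OF wS v(1)]
      by (simp add: linear_add[OF f] linear_scale[OF f] inner_add_left inner_add_right
          l_def power2_eq_square algebra_simps)
    moreover have "(v + t *\<^sub>R w) \<bullet> (v + t *\<^sub>R w) = 1 + 2 * t * (v \<bullet> w) + t\<^sup>2 * (w \<bullet> w)"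
      using v by (simp add: inner_add_left inner_add_right inner_commute[of w v]
          power2_eq_square norm_eq_1 algebra_simps)
    ultimately have "l + 2 * t * (f v \<bullet> w) + t\<^sup>2 * (f w \<bullet> w)
        \<le> l * (1 + 2 * t * (v \<bullet> w) + t\<^sup>2 * (w \<bullet> w))"
      by (simp only:)
    then have "0 \<le> 2 * t * (l * (v \<bullet> w) - f v \<bullet> w) + t\<^sup>2 * q"
      by (simp add: q_def algebra_simps)
    also have "l * (v \<bullet> w) - f v \<bullet> w = w \<bullet> w"
      by (subst (3) w_def) (simp add: inner_diff_left)
    finally show ?thesis .
  qed
  have "w \<bullet> w = 0"
  proof (rule ccontr)
    assume "w \<bullet> w \<noteq> 0"
    then have a: "w \<bullet> w > 0"
      by simp
    \<comment> \<open>Small enough that at \<open>t = - d\<close> the linear term of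
      \<open>quad\<close> outweighs the quadratic one.\<close>
    define d where "d = w \<bullet> w / (q + 1)"
    have d: "d > 0" "d * (q + 1) = w \<bullet> w"
      using a q by (auto simp: d_def)
    have "0 \<le> d * (d * q - 2 * (w \<bullet> w))"
      using quad[of "- d"] by (simp add: algebra_simps power2_eq_square)
    then have "2 * (w \<bullet> w) \<le> d * q"
      using d(1) by (simp add: zero_le_mult_iff)
    moreover have "d * q < w \<bullet> w"
      using d by (simp add: algebra_simps)
    ultimately show False
      using a by linarith
  qed
  then have "f v = l *\<^sub>R v"
    by (simp add: w_def)
  moreover have "v \<noteq> 0"
    using v by auto
  ultimately show ?thesis
    using that v le by blast
qed

text \<open>Eigenvectors chosen for distinct eigenvalues are orthogonal, hence independent.
  Finiteness gives \<open>Max\<close> and \<open>Min\<close> in \<open>sigma_max\<close> and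
  \<open>sigma_min\<close> their meaning.\<close>

lemma finite_eigenvalues_symmetric:
  fixes f :: "'a::euclidean_space \<Rightarrow> 'a"
  assumes sym: "\<And>u v. f u \<bullet> v = f v \<bullet> u"
  shows "finite {l. \<exists>v. v \<noteq> 0 \<and> f v = l *\<^sub>R v}" (is "finite ?E")
proof -
  have "\<forall>l\<in>?E. \<exists>v. v \<noteq> 0 \<and> f v = l *\<^sub>R v"
    by blast
  then obtain v where v: "\<And>l. l \<in> ?E \<Longrightarrow> v l \<noteq> 0 \<and> f (v l) = l *\<^sub>R v l"
    by metis
  have ort: "v l \<bullet> v m = 0" if "l \<in> ?E" "m \<in> ?E" "l \<noteq> m" for l m
  proof -
    have "l * (v l \<bullet> v m) = m * (v l \<bullet> v m)"
      using sym[of "v l" "v m"] v[OF that(1)] v[OF that(2)] by (simp add: inner_commute)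
    then show ?thesis
      using that(3) by simp
  qed
  have "inj_on v ?E"
    using ort v by (metis (no_types, lifting) inj_onI inner_eq_zero_iff)
  moreover have "independent (v ` ?E)"
  proof (rule pairwise_orthogonal_independent)
    show "pairwise orthogonal (v ` ?E)"
      using ort unfolding pairwise_def orthogonal_def by (metis (no_types, lifting) imageE)
    show "0 \<notin> v ` ?E"
      using v by (metis (no_types, lifting) imageE)
  qed
  then have "finite (v ` ?E)"
    by (simp add: independent_bound)
  ultimately show ?thesis
    using finite_imageD by blast
qed

lemma gram_eigenvalue_nonneg:
  fixes A :: "real^'n^'m"
  assumes "v \<noteq> 0" "transpose A *v (A *v v) = l *\<^sub>R v"
  shows "l \<ge> 0"
proof -
  have "l * (v \<bullet> v) \<ge> 0"
    using inner_gram[of A v v] assms(2) by simp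
  moreover have "v \<bullet> v > 0"
    using assms(1) by simp
  ultimately show ?thesis
    by (simp add: zero_le_mult_iff)
qed

lemma finite_singular_values: "finite (singular_values A)"
proof -
  have "finite {l. \<exists>v. v \<noteq> 0 \<and> transpose A *v (A *v v) = l *\<^sub>R v}"
    by (rule finite_eigenvalues_symmetric) (metis inner_gram inner_commute)
  then have "finite (sqrt ` {l. \<exists>v. v \<noteq> 0 \<and> transpose A *v (A *v v) = l *\<^sub>R v})"
    by simp
  also have "sqrt ` {l. \<exists>v. v \<noteq> 0 \<and> transpose A *v (A *v v) = l *\<^sub>R v} = singular_values A"
    by (auto simp: singular_values_def matrix_vector_mul_assoc)
  finally show ?thesis .
qed

lemma sqrt_eigenvalue_in_singular_values:
  assumes "v \<noteq> 0" "transpose A *v (A *v v) = l *\<^sub>R v"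
  shows "sqrt l \<in> singular_values A"
  using assms by (auto simp: singular_values_def matrix_vector_mul_assoc)

lemma inner_mult_le_sigma_max:
  fixes A :: "real^'n^'m"
  shows "(A *v u) \<bullet> (A *v u) \<le> (sigma_max A)\<^sup>2 * (u \<bullet> u)"
proof -
  obtain l v where v: "v \<noteq> 0" "transpose A *v (A *v v) = l *\<^sub>R v"
    and le: "\<And>u. (transpose A *v (A *v u)) \<bullet> u \<le> l * (u \<bullet> u)"
  proof (rule ex_maximizing_eigenvector[of "\<lambda>v. transpose A *v (A *v v)" UNIV])
    show "linear (\<lambda>v. transpose A *v (A *v v))"
      by (simp add: matrix_vector_mul_assoc matrix_vector_mul_linear)
    show "(transpose A *v (A *v u)) \<bullet> v = (transpose A *v (A *v v)) \<bullet> u" for u v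
      by (metis inner_gram inner_commute)
    show "UNIV \<noteq> {0 :: real^'n}"
      using axis_eq_0_iff[of undefined "1::real"] by fastforce
  qed auto
  have "sqrt l \<le> sigma_max A"
    unfolding sigma_max_def
    using v by (intro Max_ge finite_singular_values sqrt_eigenvalue_in_singular_values)
  moreover have "l \<ge> 0"
    using v by (rule gram_eigenvalue_nonneg)
  ultimately have "l \<le> (sigma_max A)\<^sup>2"
    by (metis power_mono real_sqrt_ge_zero real_sqrt_pow2)
  then have "l * (u \<bullet> u) \<le> (sigma_max A)\<^sup>2 * (u \<bullet> u)"
    by (intro mult_right_mono) auto
  with le[of u] show ?thesis
    by (simp add: inner_gram)
qed

text \<open>Maximising the negated Gram form on the range of \<open>transpose A\<close> minimises
  the Gram form there. The Gram matrix is injective on that range, so the minimum is a nonzero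
  eigenvalue.\<close>

lemma sigma_min_le_inner_mult:
  fixes A :: "real^'n^'m"
  assumes "A \<noteq> 0" and u: "u \<in> range ((*v) (transpose A))"
  shows "(sigma_min A)\<^sup>2 * (u \<bullet> u) \<le> (A *v u) \<bullet> (A *v u)"
proof -
  let ?W = "range ((*v) (transpose A))"
  have "transpose A \<noteq> 0"
    using assms(1) by (auto simp: transpose_def vec_eq_iff)
  then obtain y where "transpose A *v y \<noteq> 0"
    using matrix_eq[of "transpose A" 0] by auto
  then have W: "?W \<noteq> {0}"
    by blast
  obtain l v where v: "v \<in> ?W" "v \<noteq> 0" "- (transpose A *v (A *v v)) = l *\<^sub>R v"
    and le: "\<And>u. u \<in> ?W \<Longrightarrow> - (transpose A *v (A *v u)) \<bullet> u \<le> l * (u \<bullet> u)"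
  proof (rule ex_maximizing_eigenvector[of "\<lambda>v. - (transpose A *v (A *v v))" ?W])
    show "linear (\<lambda>v. - (transpose A *v (A *v v)))"
      by (intro linear_compose_neg) (simp add: matrix_vector_mul_assoc matrix_vector_mul_linear)
    show "subspace ?W"
      by (simp add: linear_subspace_image matrix_vector_mul_linear)
    show "(\<lambda>v. - (transpose A *v (A *v v))) ` ?W \<subseteq> ?W"
      using \<open>subspace ?W\<close> by (auto intro: subspace_neg)
    show "- (transpose A *v (A *v u)) \<bullet> v = - (transpose A *v (A *v v)) \<bullet> u" for u v
      by (metis inner_gram inner_commute inner_minus_left)
  qed (use W in auto)
  have eig: "transpose A *v (A *v v) = (- l) *\<^sub>R v"
    using v(3) by (metis minus_equation_iff scaleR_minus_left)
  \<comment> \<open>The kernel of \<open>A\<close> meets the range of \<open>transpose A\<close>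
    only in \<open>0\<close>.\<close>
  have "l \<noteq> 0"
  proof
    assume "l = 0"
    then have "A *v v = 0"
      using eig gram_eq_0_iff by fastforce
    moreover obtain z where "v = transpose A *v z"
      using v by auto
    ultimately show False
      using gram_eq_0_iff[of "transpose A" z] v by simp
  qed
  then have "sqrt (- l) \<in> singular_values A - {0}"
    using sqrt_eigenvalue_in_singular_values[OF v(2) eig] by simp
  then have "sigma_min A \<le> sqrt (- l)" "sigma_min A \<in> singular_values A - {0}"
    unfolding sigma_min_def
    using Min_le[of "singular_values A - {0}"] Min_in[of "singular_values A - {0}"]
      finite_singular_values[of A] by blast+
  moreover from this(2) have "sigma_min A \<ge> 0"
    using gram_eigenvalue_nonneg
    by (auto simp: singular_values_def matrix_vector_mul_assoc)
  moreover have "- l \<ge> 0"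
    using v(2) eig by (rule gram_eigenvalue_nonneg)
  ultimately have "(sigma_min A)\<^sup>2 \<le> - l"
    by (metis power_mono real_sqrt_pow2)
  then have "(sigma_min A)\<^sup>2 * (u \<bullet> u) \<le> - l * (u \<bullet> u)"
    by (intro mult_right_mono) auto
  with le[OF u] show ?thesis
    by (simp add: inner_gram)
qed

subsection \<open>The deterministic heavy ball recursion\<close>

text \<open>\<open>G\<close> will be the Gram matrix scaled by \<alpha> over the squared Frobenius
  norm, and \<open>S\<close> the range of \<open>transpose A\<close>: on the kernel of
  \<open>A\<close> the lower bound fails for positive \<open>l\<close>.\<close>

lemma heavy_ball_bound:
  fixes G :: "'a::real_inner \<Rightarrow> 'a" and e :: "nat \<Rightarrow> 'a"
  assumes G: "linear G" and S: "subspace S"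
    and sym: "\<And>u v. u \<in> S \<Longrightarrow> v \<in> S \<Longrightarrow> G u \<bullet> v = G v \<bullet> u"
    and lo: "\<And>u. u \<in> S \<Longrightarrow> l * (u \<bullet> u) \<le> G u \<bullet> u"
    and hi: "\<And>u. u \<in> S \<Longrightarrow> G u \<bullet> u \<le> u \<bullet> u"
    and l: "0 \<le> l" "(1 - sqrt l)\<^sup>2 < \<omega>" and \<omega>: "\<omega> < 1"
    and e: "\<And>k. e k \<in> S"
    and rec: "\<And>k. e (k + 2) = e (k + 1) - G (e (k + 1)) + \<omega> *\<^sub>R (e (k + 1) - e k)"
  shows "\<exists>c>0. \<forall>k. (norm (e k))\<^sup>2 \<le> \<omega> ^ k * c"
proof -
  have \<omega>0: "\<omega> > 0"
    using l(2) zero_le_power2[of "1 - sqrt l"] by linarith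
  define r where "r = sqrt \<omega>"
  have r: "0 < r" "r < 1" "r * r = \<omega>"
    using \<omega>0 \<omega> by (auto simp: r_def)
  \<comment> \<open>Equivalently \<open>1 - r < sqrt l\<close>; squaring this gives the bound on
    \<open>1 + \<omega> - l\<close>.\<close>
  have "1 - sqrt l < r"
    unfolding r_def using l(2) by (rule real_less_rsqrt)
  then have "(1 - r)\<^sup>2 < (sqrt l)\<^sup>2"
    using r by (intro power_strict_mono) auto
  then have \<beta>: "1 + \<omega> - l < 2 * r"
    using l(1) r(3) by (simp add: power2_eq_square algebra_simps)
  \<comment> \<open>Chosen so that \<open>1 + \<omega> - l = 2 * r * (1 - \<delta>)\<close>.\<close>
  define \<delta> where "\<delta> = 1 - (1 + \<omega> - l) / (2 * r)"
  have \<delta>: "\<delta> > 0"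
    using \<beta> r by (simp add: \<delta>_def)
  define B where "B u = (1 + \<omega>) *\<^sub>R u - G u" for u
  have B_diff: "B (u - v) = B u - B v" and B_scale: "B (a *\<^sub>R u) = a *\<^sub>R B u" for u v a
    by (simp_all add: B_def linear_diff[OF G] linear_scale[OF G] algebra_simps)
  have B_sym: "B u \<bullet> v = B v \<bullet> u" if "u \<in> S" "v \<in> S" for u v
    using sym[OF that] by (simp add: B_def inner_diff_left inner_commute[of v u])
  have B_nonneg: "0 \<le> B u \<bullet> u" if "u \<in> S" for u
  proof -
    have "0 \<le> \<omega> * (u \<bullet> u)"
      using \<omega>0 by simp
    with hi[OF that] show ?thesis
      by (simp add: B_def inner_diff_left distrib_right)
  qed
  have B_le: "B u \<bullet> u \<le> (1 + \<omega> - l) * (u \<bullet> u)" if "u \<in> S" for u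
    using lo[OF that] by (simp add: B_def inner_diff_left algebra_simps)
  define V where "V u v = u \<bullet> u - B u \<bullet> v + \<omega> * (v \<bullet> v)" for u v
  have V_ge: "\<delta> * (u \<bullet> u) \<le> V u v" if uv: "u \<in> S" "v \<in> S" for u v
  proof -
    \<comment> \<open>With this scaling \<open>V\<close> weighs \<open>u\<close> and
      \<open>w\<close> equally, and positivity of \<open>B\<close> at \<open>u - w\<close> bounds
      the cross term.\<close>
    define w where "w = r *\<^sub>R v"
    have w: "w \<in> S"
      using uv S by (auto simp: w_def intro: subspace_scale)
    have "w \<bullet> w = r * r * (v \<bullet> v)"
      by (simp add: w_def)
    then have ww: "w \<bullet> w = \<omega> * (v \<bullet> v)"
      using r(3) by simp
    have "0 \<le> B (u - w) \<bullet> (u - w)"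
      using uv w S by (intro B_nonneg subspace_diff)
    then have "2 * (B u \<bullet> w) \<le> B u \<bullet> u + B w \<bullet> w"
      using B_sym[OF uv(1) w] by (simp add: B_diff inner_diff_left inner_diff_right)
    also have "\<dots> \<le> (1 + \<omega> - l) * (u \<bullet> u + \<omega> * (v \<bullet> v))"
      using B_le[OF uv(1)] B_le[OF w] unfolding ww by (simp only: distrib_left)
    finally have "2 * r * (B u \<bullet> v) \<le> (1 + \<omega> - l) * (u \<bullet> u + \<omega> * (v \<bullet> v))"
      by (simp add: w_def)
    then have "B u \<bullet> v \<le> (1 - \<delta>) * (u \<bullet> u + \<omega> * (v \<bullet> v))"
      using r(1) by (simp add: \<delta>_def field_simps)
    then have "\<delta> * (u \<bullet> u) + \<delta> * (\<omega> * (v \<bullet> v)) \<le> V u v"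
      by (simp add: V_def algebra_simps)
    moreover have "0 \<le> \<delta> * (\<omega> * (v \<bullet> v))"
      using \<delta> \<omega>0 by simp
    ultimately show ?thesis
      by linarith
  qed
  \<comment> \<open>After moving \<open>B\<close> to \<open>e (k + 1)\<close> by symmetry,
    \<open>e (k + 2) - B (e (k + 1))\<close> collapses to
    \<open>- \<omega> *\<^sub>R e k\<close>.\<close>
  have V_step: "V (e (k + 2)) (e (k + 1)) = \<omega> * V (e (k + 1)) (e k)" for k
  proof -
    have e2: "e (k + 2) = B (e (k + 1)) - \<omega> *\<^sub>R e k"
      unfolding rec[of k] by (simp add: B_def algebra_simps)
    show ?thesis
      unfolding V_def B_sym[OF e[of "k + 2"] e[of "k + 1"]] unfolding e2
      by (simp add: inner_diff_left inner_diff_right inner_commute algebra_simps)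
  qed
  have V_pow: "V (e (k + 1)) (e k) = \<omega> ^ k * V (e 1) (e 0)" for k
    by (induction k) (use V_step in \<open>simp_all add: algebra_simps\<close>)
  \<comment> \<open>The first term serves \<open>k = 0\<close>. For \<open>k = j + 1\<close> the
    decay gives only \<open>\<omega> ^ j\<close>, hence the extra \<omega> in the denominator. The
    \<open>1\<close> ensures positivity.\<close>
  define c where "c = (norm (e 0))\<^sup>2 + V (e 1) (e 0) / (\<delta> * \<omega>) + 1"
  have "0 \<le> \<delta> * (e 1 \<bullet> e 1)"
    using \<delta> by simp
  then have V0: "0 \<le> V (e 1) (e 0)"
    using V_ge[OF e[of 1] e[of 0]] by linarith
  then have c: "(norm (e 0))\<^sup>2 \<le> c" "V (e 1) (e 0) / (\<delta> * \<omega>) \<le> c" "c > 0"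
    using \<delta> \<omega>0 by (auto simp: c_def add_nonneg_pos)
  have "(norm (e k))\<^sup>2 \<le> \<omega> ^ k * c" for k
  proof (cases k)
    case 0
    then show ?thesis
      using c by simp
  next
    case (Suc j)
    have "\<delta> * (norm (e (j + 1)))\<^sup>2 \<le> \<omega> ^ j * V (e 1) (e 0)"
      using V_ge[OF e[of "j + 1"] e[of j]] V_pow[of j] by (simp add: power2_norm_eq_inner)
    then have "(norm (e k))\<^sup>2 \<le> \<omega> ^ k * (V (e 1) (e 0) / (\<delta> * \<omega>))"
      using \<delta> \<omega>0 Suc by (simp add: field_simps)
    also have "\<dots> \<le> \<omega> ^ k * c"
      using c \<omega>0 by (intro mult_left_mono) auto
    finally show ?thesis .
  qed
  with c show ?thesis
    by blast
qed

subsection \<open>Expectations of the iterates\<close>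

context prob_space
begin

text \<open>Independence is assumed entrywise because \<open>indep_var\<close> relates variables of one type only.\<close>

lemma indep_matrix_vector_mult:
  fixes S :: "'a \<Rightarrow> real^'n^'m" and v :: "'a \<Rightarrow> real^'n"
  assumes ind: "\<And>i j. indep_var borel (\<lambda>\<xi>. S \<xi> $ i $ j) borel (\<lambda>\<xi>. v \<xi> $ j)"
    and S: "integrable M S" and v: "integrable M v"
  shows "integrable M (\<lambda>\<xi>. S \<xi> *v v \<xi>)"
    and "expectation (\<lambda>\<xi>. S \<xi> *v v \<xi>) = expectation S *v expectation v"
proof -
  have S_comp: "bounded_linear (\<lambda>X :: real^'n^'m. X $ i $ j)" for i j
    using bounded_linear_compose[OF bounded_linear_vec_nth bounded_linear_vec_nth] .
  have int_S: "integrable M (\<lambda>\<xi>. S \<xi> $ i $ j)" "expectation (\<lambda>\<xi>. S \<xi> $ i $ j) = expectation S $ i $ j" for i j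
    using integrable_bounded_linear[OF S_comp S] integral_bounded_linear[OF S_comp S] by auto
  have int_v: "integrable M (\<lambda>\<xi>. v \<xi> $ j)" "expectation (\<lambda>\<xi>. v \<xi> $ j) = expectation v $ j" for j
    using integrable_bounded_linear[OF bounded_linear_vec_nth v]
      integral_bounded_linear[OF bounded_linear_vec_nth v] by auto
  \<comment> \<open>Independence makes the product of two integrable entries integrable.\<close>
  note int = indep_var_integrable[OF ind int_S(1) int_v(1)]
  have eq: "S \<xi> *v v \<xi> = (\<Sum>i\<in>UNIV. \<Sum>j\<in>UNIV. (S \<xi> $ i $ j * v \<xi> $ j) *\<^sub>R axis i 1)" for \<xi>
  proof -
    have "(\<Sum>i\<in>UNIV. \<Sum>j\<in>UNIV. (S \<xi> $ i $ j * v \<xi> $ j) *\<^sub>R axis i 1) $ k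
      = (\<Sum>i\<in>UNIV. if i = k then \<Sum>j\<in>UNIV. S \<xi> $ i $ j * v \<xi> $ j else 0)" for k :: 'm
      unfolding sum_component by (rule sum.cong) (auto simp: axis_def)
    then show ?thesis
      by (simp add: vec_eq_iff matrix_vector_mult_def)
  qed
  show int': "integrable M (\<lambda>\<xi>. S \<xi> *v v \<xi>)"
    unfolding eq by (intro Bochner_Integration.integrable_sum integrable_scaleR_left int)
  show "expectation (\<lambda>\<xi>. S \<xi> *v v \<xi>) = expectation S *v expectation v"
  proof (rule vec_eq_iff[THEN iffD2, rule_format])
    fix i
    have "expectation (\<lambda>\<xi>. S \<xi> *v v \<xi>) $ i = expectation (\<lambda>\<xi>. (S \<xi> *v v \<xi>) $ i)"
      using integral_bounded_linear[OF bounded_linear_vec_nth int'] by simp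
    also have "\<dots> = (\<Sum>j\<in>UNIV. expectation (\<lambda>\<xi>. S \<xi> $ i $ j * v \<xi> $ j))"
      unfolding matrix_vector_mult_def by (simp add: int)
    also have "\<dots> = (expectation S *v expectation v) $ i"
      by (simp add: indep_var_lebesgue_integral[OF ind int_S(1) int_v(1)] int_S int_v
          matrix_vector_mult_def)
    finally show "expectation (\<lambda>\<xi>. S \<xi> *v v \<xi>) $ i = (expectation S *v expectation v) $ i" .
  qed
qed

end

text \<open>Exhibits each iterate as a measurable function of the draws before it, the form in which
  independence of the next draw can be applied. Strong induction, as the recursion looks back two
  steps.\<close>

lemma second_order_recursion_adapted:
  assumes a: "a \<in> space K"
    and F: "(\<lambda>(q, u, v). F q u v) \<in> N \<Otimes>\<^sub>M K \<Otimes>\<^sub>M K \<rightarrow>\<^sub>M K"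
    and x: "\<And>\<xi>. \<xi> \<in> \<Omega> \<Longrightarrow> x 0 \<xi> = a" "\<And>\<xi>. \<xi> \<in> \<Omega> \<Longrightarrow> x (1::nat) \<xi> = a"
      "\<And>k \<xi>. k \<ge> 1 \<Longrightarrow> \<xi> \<in> \<Omega> \<Longrightarrow> x (k + 1) \<xi> = F (Q k \<xi>) (x k \<xi>) (x (k - 1) \<xi>)"
  shows "\<exists>f \<in> (\<Pi>\<^sub>M i\<in>{1..<k}. N) \<rightarrow>\<^sub>M K. \<forall>\<xi>\<in>\<Omega>. x k \<xi> = f (\<lambda>i\<in>{1..<k}. Q i \<xi>)"
proof (induction k rule: less_induct)
  case (less k)
  consider "k = 0" | "k = 1" | "k \<ge> 2"
    by linarith
  then show ?case
  proof cases
    case 3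
    define j where "j = k - 2"
    with 3 have k: "k = j + 2"
      by simp
    have "j + 1 < k" "j < k"
      using k by auto
    then obtain f g where f: "f \<in> (\<Pi>\<^sub>M i\<in>{1..<j + 1}. N) \<rightarrow>\<^sub>M K"
        "\<And>\<xi>. \<xi> \<in> \<Omega> \<Longrightarrow> x (j + 1) \<xi> = f (\<lambda>i\<in>{1..<j + 1}. Q i \<xi>)"
      and g: "g \<in> (\<Pi>\<^sub>M i\<in>{1..<j}. N) \<rightarrow>\<^sub>M K"
        "\<And>\<xi>. \<xi> \<in> \<Omega> \<Longrightarrow> x j \<xi> = g (\<lambda>i\<in>{1..<j}. Q i \<xi>)"
      using less.IH by meson
    let ?P = "\<Pi>\<^sub>M i\<in>{1..<k}. N"
    \<comment> \<open>The newest draw \<open>j + 1 = k - 1\<close> is the last index of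
      \<open>{1..<k}\<close>; the two earlier iterates read restrictions of the same
      history.\<close>
    define h where "h \<omega> = F (\<omega> (j + 1)) (f (restrict \<omega> {1..<j + 1})) (g (restrict \<omega> {1..<j}))" for \<omega>
    have "(\<lambda>\<omega>. (\<omega> (j + 1), f (restrict \<omega> {1..<j + 1}), g (restrict \<omega> {1..<j})))
        \<in> ?P \<rightarrow>\<^sub>M N \<Otimes>\<^sub>M K \<Otimes>\<^sub>M K"
      using k by (intro measurable_Pair measurable_component_singleton
          measurable_compose[OF measurable_restrict_subset f(1)]
          measurable_compose[OF measurable_restrict_subset g(1)]) auto
    from measurable_compose[OF this F] have "h \<in> ?P \<rightarrow>\<^sub>M K"
      by (simp add: h_def[abs_def])
    moreover have "x k \<xi> = h (\<lambda>i\<in>{1..<k}. Q i \<xi>)" if "\<xi> \<in> \<Omega>" for \<xi>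
    proof -
      have "{1..<k} \<inter> {1..<j + 1} = {1..<j + 1}" "{1..<k} \<inter> {1..<j} = {1..<j}"
        using k by auto
      then show ?thesis
        using x(3)[of "j + 1" \<xi>] that k f(2) g(2) by (simp add: h_def)
    qed
    ultimately show ?thesis
      by blast
  qed (use a x in \<open>auto intro!: bexI[of _ "\<lambda>_. a"]\<close>)
qed

lemma borel_measurable_matrix_vector_mult [measurable (raw)]:
  fixes S :: "'a \<Rightarrow> real^'n^'m"
  assumes "S \<in> borel_measurable M" "v \<in> borel_measurable M"
  shows "(\<lambda>\<xi>. S \<xi> *v v \<xi>) \<in> borel_measurable M"
  using assms
proof (rule borel_measurable_continuous_Pair)
  show "continuous_on UNIV (\<lambda>x :: (real^'n^'m) \<times> (real^'n). fst x *v snd x)"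
    unfolding matrix_vector_mult_def by (intro continuous_intros)
qed

theorem theorem4p2:
  fixes A :: "real^'n^'m" and b :: "real^'m"
    and D :: "('m, 'n) quadruple measure"
    and M :: "'w measure"
    and Q :: "nat \<Rightarrow> 'w \<Rightarrow> ('m, 'n) quadruple"
    and x0 xstar :: "real^'n"
    and x :: "nat \<Rightarrow> 'w \<Rightarrow> real^'n"
    and \<alpha> \<omega> :: real
  assumes "A \<noteq> 0"
    and "prob_space D" and "sets D = sets borel"
    and "integrable D (sketch A)"
    and "(\<integral>q. sketch A q \<partial>D) = (1 / (norm A)\<^sup>2) *\<^sub>R transpose A"
    and "prob_space M"
    and "prob_space.indep_vars M (\<lambda>_. borel) Q {1..}"
    and "\<And>k. k \<ge> 1 \<Longrightarrow> distr M borel (Q k) = D"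
    and "xstar = pseudoinverse A *v b + (mat 1 - pseudoinverse A ** A) *v x0"
    and "\<And>\<xi>. \<xi> \<in> space M \<Longrightarrow> x 0 \<xi> = x0"
    and "\<And>\<xi>. \<xi> \<in> space M \<Longrightarrow> x 1 \<xi> = x0"
    and "\<And>k \<xi>. k \<ge> 1 \<Longrightarrow> \<xi> \<in> space M \<Longrightarrow>
           x (k + 1) \<xi> = x k \<xi> - \<alpha> *\<^sub>R (sketch A (Q k \<xi>) *v (A *v x k \<xi> - b))
                          + \<omega> *\<^sub>R (x k \<xi> - x (k - 1) \<xi>)"
    and "\<And>k. integrable M (x k)"
    and "0 < \<alpha>" and "\<alpha> \<le> (norm A)\<^sup>2 / (sigma_max A)\<^sup>2"
    and "(1 - sqrt (\<alpha> * (sigma_min A)\<^sup>2 / (norm A)\<^sup>2))\<^sup>2 < \<omega>" and "\<omega> < 1"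
  shows "\<exists>c>0. \<forall>k. (norm (\<integral>\<xi>. (x k \<xi> - xstar) \<partial>M))\<^sup>2 \<le> \<omega> ^ k * c"
proof -
  interpret prob_space M by fact
  have sketch_meas [measurable]: "sketch A \<in> borel_measurable borel"
    using borel_measurable_integrable[OF assms(4)] measurable_cong_sets[OF assms(3) refl] by blast
  have Q_meas [measurable]: "random_variable borel (Q k)" if "k \<ge> 1" for k
    using assms(7) that by (auto simp: indep_vars_def2)
  have int_x: "integrable M (x k)" for k
    by fact
  define F where "F q u v = u - \<alpha> *\<^sub>R (sketch A q *v (A *v u - b)) + \<omega> *\<^sub>R (u - v)" for q u v
  have F_meas: "(\<lambda>(q, u, v). F q u v) \<in> borel \<Otimes>\<^sub>M borel \<Otimes>\<^sub>M borel \<rightarrow>\<^sub>M borel"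
    unfolding F_def by measurable
  have sketch_step:
    "integrable M (\<lambda>\<xi>. sketch A (Q k \<xi>) *v (A *v x k \<xi> - b)) \<and>
     expectation (\<lambda>\<xi>. sketch A (Q k \<xi>) *v (A *v x k \<xi> - b))
       = (1 / (norm A)\<^sup>2) *\<^sub>R (transpose A *v (A *v expectation (x k) - b))"
    if k: "k \<ge> 1" for k
  proof -
    obtain f where f [measurable]: "f \<in> (\<Pi>\<^sub>M i\<in>{1..<k}. borel) \<rightarrow>\<^sub>M borel"
      and xf: "\<And>\<xi>. \<xi> \<in> space M \<Longrightarrow> x k \<xi> = f (\<lambda>i\<in>{1..<k}. Q i \<xi>)"
      using second_order_recursion_adapted[OF _ F_meas, of x0 "space M" x Q k] assms(10-12)
      by (auto simp: F_def)
    \<comment> \<open>A function of the history on the whole type; it is known to equal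
      \<open>A *v x k \<xi> - b\<close> only on \<open>space M\<close>.\<close>
    define v where "v \<xi> = A *v f (\<lambda>i\<in>{1..<k}. Q i \<xi>) - b" for \<xi>
    have v: "A *v x k \<xi> - b = v \<xi>" if "\<xi> \<in> space M" for \<xi>
      using xf[OF that] by (simp add: v_def)
    have "integrable M (\<lambda>\<xi>. A *v x k \<xi> - b)"
      and Ev: "expectation (\<lambda>\<xi>. A *v x k \<xi> - b) = A *v expectation (x k) - b"
      using integrable_bounded_linear[OF matrix_vector_mul_bounded_linear[of A] int_x[of k]]
        integral_bounded_linear[OF matrix_vector_mul_bounded_linear[of A] int_x[of k]]
      by (simp_all add: prob_space)
    then have int_v: "integrable M v"
      using v by (simp cong: Bochner_Integration.integrable_cong)
    have int_S: "integrable M (\<lambda>\<xi>. sketch A (Q k \<xi>))"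
      using assms(4) assms(8)[OF k] integrable_distr[OF Q_meas[OF k], of "sketch A"] by simp
    have ES: "expectation (\<lambda>\<xi>. sketch A (Q k \<xi>)) = (1 / (norm A)\<^sup>2) *\<^sub>R transpose A"
      using assms(5) assms(8)[OF k] integral_distr[OF Q_meas[OF k] sketch_meas] by simp
    have ind: "indep_var borel (\<lambda>\<xi>. sketch A (Q k \<xi>) $ i $ j) borel (\<lambda>\<xi>. v \<xi> $ j)" for i j
    proof -
      \<comment> \<open>The index sets \<open>{k}\<close> and \<open>{1..<k}\<close> are disjoint;
        entries of the sketch and of \<open>v\<close> are then taken on either side.\<close>
      have "indep_var (\<Pi>\<^sub>M i\<in>{k}. borel) (\<lambda>\<xi>. \<lambda>i\<in>{k}. Q i \<xi>)
              (\<Pi>\<^sub>M i\<in>{1..<k}. borel) (\<lambda>\<xi>. \<lambda>i\<in>{1..<k}. Q i \<xi>)"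
        using k by (intro indep_var_restrict[OF assms(7)]) auto
      moreover have "(\<lambda>X :: real^'m^'n. X $ i $ j) \<in> borel_measurable borel"
        by (intro borel_measurable_continuous_onI continuous_intros)
      then have "(\<lambda>q. sketch A (q k) $ i $ j) \<in> borel_measurable (\<Pi>\<^sub>M i\<in>{k}. borel)"
        by (intro measurable_compose[OF measurable_component_singleton]
            measurable_compose[OF sketch_meas]) auto
      moreover have "(\<lambda>u :: real^'m. u $ j) \<in> borel_measurable borel"
        by (intro borel_measurable_continuous_onI continuous_intros)
      then have "(\<lambda>q. (A *v f q - b) $ j) \<in> borel_measurable (\<Pi>\<^sub>M i\<in>{1..<k}. borel)"
        by measurable
      ultimately have "indep_var borel ((\<lambda>q. sketch A (q k) $ i $ j) \<circ> (\<lambda>\<xi>. \<lambda>i\<in>{k}. Q i \<xi>))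
         borel ((\<lambda>q. (A *v f q - b) $ j) \<circ> (\<lambda>\<xi>. \<lambda>i\<in>{1..<k}. Q i \<xi>))"
        by (rule indep_var_compose)
      then show ?thesis
        by (simp add: comp_def v_def)
    qed
    have "integrable M (\<lambda>\<xi>. sketch A (Q k \<xi>) *v v \<xi>)"
      and "expectation (\<lambda>\<xi>. sketch A (Q k \<xi>) *v v \<xi>)
        = ((1 / (norm A)\<^sup>2) *\<^sub>R transpose A) *v expectation v"
      using indep_matrix_vector_mult[OF ind int_S int_v] ES by simp_all
    moreover have "expectation v = A *v expectation (x k) - b"
      unfolding Ev[symmetric] by (rule Bochner_Integration.integral_cong) (simp_all add: v)
    ultimately show ?thesis
      using v by (simp add: scaleR_matrix_vector_assoc
          cong: Bochner_Integration.integrable_cong Bochner_Integration.integral_cong)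
  qed
  define \<mu> where "\<mu> = \<alpha> / (norm A)\<^sup>2"
  define G where "G u = \<mu> *\<^sub>R (transpose A *v (A *v u))" for u
  define e where "e k = expectation (\<lambda>\<xi>. x k \<xi> - xstar)" for k
  have e_eq: "e k = expectation (x k) - xstar" for k
    using int_x by (simp add: e_def prob_space)
  \<comment> \<open>The two terms in \<open>x0\<close> cancel, leaving \<open>xstar\<close> with the
    same normal equations as \<open>b\<close>.\<close>
  have normal: "transpose A *v (A *v u - b) = transpose A *v (A *v (u - xstar))" for u
  proof -
    let ?X = "pseudoinverse A"
    have "transpose A *v (A *v xstar) = (transpose A ** (A ** ?X)) *v b + transpose A *v (A *v x0)
        - (transpose A ** (A ** ?X)) *v (A *v x0)"
      unfolding assms(9) by (simp add: matrix_vector_right_distrib matrix_vector_mult_diff_distrib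
          matrix_vector_mult_diff_rdistrib matrix_vector_mul_assoc[symmetric])
    also have "\<dots> = transpose A *v b"
      by (simp add: transpose_mult_pseudoinverse)
    finally show ?thesis
      by (simp add: matrix_vector_mult_diff_distrib)
  qed
  have rec: "e (k + 2) = e (k + 1) - G (e (k + 1)) + \<omega> *\<^sub>R (e (k + 1) - e k)" for k
  proof -
    note step = sketch_step[of "k + 1", simplified]
    have "expectation (x (k + 2)) = expectation (\<lambda>\<xi>. x (k + 1) \<xi>
        - \<alpha> *\<^sub>R (sketch A (Q (k + 1) \<xi>) *v (A *v x (k + 1) \<xi> - b)) + \<omega> *\<^sub>R (x (k + 1) \<xi> - x k \<xi>))"
      using assms(12)[of "k + 1"] by (intro Bochner_Integration.integral_cong) simp_all
    also have "\<dots> = expectation (x (k + 1)) - \<mu> *\<^sub>R (transpose A *v (A *v expectation (x (k + 1)) - b))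
        + \<omega> *\<^sub>R (expectation (x (k + 1)) - expectation (x k))"
      using step int_x by (simp add: \<mu>_def)
    finally show ?thesis
      unfolding normal e_eq G_def by simp
  qed
  let ?W = "range ((*v) (transpose A))"
  have W: "subspace ?W"
    by (simp add: linear_subspace_image matrix_vector_mul_linear)
  have "x0 - xstar = pseudoinverse A *v (A *v x0 - b)"
    unfolding assms(9) by (simp add: matrix_vector_mult_diff_distrib
        matrix_vector_mult_diff_rdistrib matrix_vector_mul_assoc[symmetric])
  then have "x0 - xstar \<in> ?W"
    using pseudoinverse_in_range_transpose by metis
  moreover have "e 0 = x0 - xstar" "e 1 = x0 - xstar"
    unfolding e_def using assms(10,11)
    by (simp_all add: prob_space cong: Bochner_Integration.integral_cong)
  ultimately have e01: "e 0 \<in> ?W" "e 1 \<in> ?W"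
    by simp_all
  have G_W: "G u \<in> ?W" for u
    unfolding G_def by (intro subspace_scale[OF W]) simp
  \<comment> \<open>Consecutive pairs are carried along because the recursion is of second
    order.\<close>
  have "e k \<in> ?W \<and> e (k + 1) \<in> ?W" for k
  proof (induction k)
    case (Suc k)
    then have "e (k + 2) \<in> ?W"
      unfolding rec by (intro subspace_add subspace_diff subspace_scale W G_W) simp_all
    with Suc show ?case
      by simp
  qed (use e01 in simp)
  then have e_W: "e k \<in> ?W" for k
    by blast
  have \<mu>0: "\<mu> > 0"
    using assms(1,14) by (simp add: \<mu>_def)
  \<comment> \<open>Otherwise division by zero yields \<open>0\<close>, and the upper bound on
    \<alpha> contradicts its positivity.\<close>
  have "sigma_max A \<noteq> 0"
    using assms(14,15) by auto
  then have \<mu>_max: "\<mu> * (sigma_max A)\<^sup>2 \<le> 1"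
    using assms(1,15) by (simp add: \<mu>_def field_simps)
  have "\<exists>c>0. \<forall>k. (norm (e k))\<^sup>2 \<le> \<omega> ^ k * c"
  proof (rule heavy_ball_bound[where G = G and S = ?W and l = "\<mu> * (sigma_min A)\<^sup>2"])
    show "linear G"
      unfolding G_def[abs_def]
      by (intro linear_compose_scale_right) (simp add: matrix_vector_mul_assoc matrix_vector_mul_linear)
    show "G u \<bullet> v = G v \<bullet> u" for u v
      unfolding G_def by (metis inner_gram inner_commute inner_scaleR_left)
    show "\<mu> * (sigma_min A)\<^sup>2 * (u \<bullet> u) \<le> G u \<bullet> u" if "u \<in> ?W" for u
      using mult_left_mono[OF sigma_min_le_inner_mult[OF assms(1) that], of \<mu>] \<mu>0
      by (simp add: G_def inner_gram mult.assoc)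
    show "G u \<bullet> u \<le> u \<bullet> u" for u
    proof -
      have "G u \<bullet> u \<le> \<mu> * (sigma_max A)\<^sup>2 * (u \<bullet> u)"
        using mult_left_mono[OF inner_mult_le_sigma_max[of A u], of \<mu>] \<mu>0
        by (simp add: G_def inner_gram mult.assoc)
      also have "\<dots> \<le> 1 * (u \<bullet> u)"
        using \<mu>_max by (intro mult_right_mono) auto
      finally show ?thesis
        by simp
    qed
    show "(1 - sqrt (\<mu> * (sigma_min A)\<^sup>2))\<^sup>2 < \<omega>"
      using assms(16) by (simp add: \<mu>_def)
  qed (use W \<mu>0 assms(17) e_W rec in auto)
  then show ?thesis
    unfolding e_def .
qed

end
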